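(* Let $M_{a,b}$ be an arithmetical congruence monoid. If $a = 1$, then for each fixed $x \in M_{a,b}$ with $x > 1$, we have, as functions of $n \ge 1$, \[ \ell_1^m(x^n) \in \Theta(n), \qquad \ell_\infty^m(x^n) \in \Theta(n), \qquad \text{and} \qquad \ell_0^M(x^n) \in \Theta(1). \]
   Context: For integers $a, b \ge 1$ satisfying $a^2 \equiv a \bmod b$, the arithmetical congruence monoid (ACM) is the multiplicative submonoid $M_{a,b} = \{1\} \cup \{n \in \mathbb{Z}_{\ge 1} : n \equiv a \bmod b\}$ of $\mathbb{Z}_{\ge 1}$. An atom of $M_{a,b}$ is an irreducible element: an element $u \ne 1$ of $M_{a,b}$ that is not a product of two elements of $M_{a,b} \setminus \{1\}$. For $x \in M_{a,b}$, the set of factorization tuples of $x$ is $\mathsf{Z}(x) = \{\mathbf{z} \in \mathbb{Z}_{\ge 0}^k : x = u_1^{z_1} \cdots u_k^{z_k} \text{ for some } k \ge 0 \text{ and distinct atoms } u_1, \ldots, u_k \in M_{a,b}\}$. For a tuple $\mathbf{z} = (z_1, \ldots, z_k)$, let $\ell_0(\mathbf{z})$ be the number of nonzero entries of $\mathbf{z}$ (i.e. $z_1^0 + \cdots + z_k^0$ with the convention $0^0 = 0$), $\ell_1(\mathbf{z}) = z_1 + \cdots + z_k$, and $\ell_\infty(\mathbf{z}) = \max(z_1, \ldots, z_k)$. For $p \in \{0, 1, \infty\}$, let $\ell_p^M(x) = \max\{\ell_p(\mathbf{z}) : \mathbf{z} \in \mathsf{Z}(x)\}$ and $\ell_p^m(x)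 = \min\{\ell_p(\mathbf{z}) : \mathbf{z} \in \mathsf{Z}(x)\}$ (the superscripts $M$, $m$ stand for maximum and minimum and are not exponents). *)

theory Defs
  imports "HOL-Number_Theory.Cong" "HOL-Library.Landau_Symbols"
begin

text \<open>Arithmetical congruence monoids, as multiplicative submonoids of the positive integers.
  The condition \<open>a\<^sup>2 \<equiv> a (mod b)\<close> (with \<open>a, b \<ge> 1\<close>), which makes the set below closed under
  multiplication, is the separate predicate \<open>acm_params\<close>.\<close>

definition acm_params :: "nat \<Rightarrow> nat \<Rightarrow> bool" where
  "acm_params a b \<longleftrightarrow> a \<ge> 1 \<and> b \<ge> 1 \<and> [a ^ 2 = a] (mod b)"

definition acm :: "nat \<Rightarrow> nat \<Rightarrow> nat set" where
  "acm a b = {1} \<union> {n. n \<ge> 1 \<and> [n = a] (mod b)}"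

definition acm_atoms :: "nat \<Rightarrow> nat \<Rightarrow> nat set" where
  "acm_atoms a b =
     {u \<in> acm a b. u \<noteq> 1 \<and> \<not> (\<exists>v \<in> acm a b - {1}. \<exists>w \<in> acm a b - {1}. u = v * w)}"

text \<open>A tuple \<open>(z\<^sub>1, \<dots>, z\<^sub>k)\<close> of arbitrary length \<open>k \<ge> 0\<close> is a list of natural numbers.
  Zero entries are allowed.\<close>

definition factorization_tuples :: "nat \<Rightarrow> nat \<Rightarrow> nat \<Rightarrow> nat list set" where
  "factorization_tuples a b x =
     {z. \<exists>us. length us = length z \<and> distinct us \<and> set us \<subseteq> acm_atoms a b \<and>
              x = (\<Prod>i<length z. (us ! i) ^ (z ! i))}"

definition ell0 :: "nat list \<Rightarrow> nat" where
  "ell0 z = length (filter (\<lambda>e. e \<noteq> 0) z)"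

definition ell1 :: "nat list \<Rightarrow> nat" where
  "ell1 z = sum_list z"

text \<open>Inserting \<open>0\<close> only matters for the empty tuple, which is given the value \<open>0\<close>.\<close>

definition ell_inf :: "nat list \<Rightarrow> nat" where
  "ell_inf z = Max (insert 0 (set z))"

text \<open>Below, \<open>ell\<close> is one of \<open>ell0\<close>, \<open>ell1\<close>, \<open>ell_inf\<close>.  Although there are infinitely many
  factorization tuples whenever there are infinitely many atoms (because of the zero entries), these
  three functions take only finitely many values on them when \<open>x \<ge> 1\<close>: atoms are at least \<open>2\<close>, so
  each value is at most the base-2 logarithm of \<open>x\<close>.  For \<open>x \<in> acm a b\<close> the set of values is also
  nonempty, so that \<open>Max\<close> and \<open>Min\<close> are a genuine maximum and minimum.\<close>

definition ell_max :: "(nat list \<Rightarrow> nat) \<Rightarrow> nat \<Rightarrow> nat \<Rightarrow> nat \<Rightarrow> nat" where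
  "ell_max ell a b x = Max (ell ` factorization_tuples a b x)"

definition ell_min :: "(nat list \<Rightarrow> nat) \<Rightarrow> nat \<Rightarrow> nat \<Rightarrow> nat \<Rightarrow> nat" where
  "ell_min ell a b x = Min (ell ` factorization_tuples a b x)"

end

theory Submission
  imports Defs "HOL-Number_Theory.Residues"
begin

text \<open>If \<open>a = 1\<close> and \<open>t = \<phi>(b)\<close>, then \<open>p ^ t \<equiv> 1 (mod b)\<close> for every prime \<open>p\<close> not dividing \<open>b\<close>, so an
  atom divisible by \<open>p ^ t\<close> is equal to \<open>p ^ t\<close>. Hence every atom occurring in a factorization of a
  power of \<open>x\<close> divides \<open>x ^ t\<close>. So the number of these atoms is bounded independently of \<open>n\<close>, and
  comparing sizes shows that a factorization of \<open>x ^ n\<close> has at least \<open>n / t\<close> atoms; by pigeonhole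
  one of them is repeated a number of times linear in \<open>n\<close>.\<close>

section \<open>Existence of factorizations into atoms\<close>

lemma prod_mset_in_factorization_tuples:
  assumes "set_mset A \<subseteq> acm_atoms a b"
  shows "\<exists>z. z \<in> factorization_tuples a b (prod_mset A)"
proof -
  obtain us where us: "set us = set_mset A" "distinct us"
    using finite_distinct_list[OF finite_set_mset[of A]] by auto
  have "prod_mset A = (\<Prod>u\<in>set us. u ^ count A u)"
    by (simp add: us(1) prod_mset_multiplicity)
  also have "\<dots> = (\<Prod>i<length us. (us ! i) ^ count A (us ! i))"
    by (rule prod.reindex_bij_betw[symmetric]) (use us(2) in \<open>auto intro: bij_betw_nth\<close>)
  finally have "map (count A) us \<in> factorization_tuples a b (prod_mset A)"
    unfolding factorization_tuples_def using us assms by (auto intro!: exI[of _ us])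
  then show ?thesis ..
qed

lemma acm_ge_1: "y \<in> acm a b \<Longrightarrow> y \<ge> 1"
  by (auto simp: acm_def)

text \<open>Strong induction: an element that is neither 1 nor an atom splits into two factors
  greater than 1, both therefore smaller than it.\<close>

lemma acm_eq_prod_mset_atoms:
  assumes "y \<in> acm a b"
  shows "\<exists>A. set_mset A \<subseteq> acm_atoms a b \<and> prod_mset A = y"
  using assms
proof (induction y rule: less_induct)
  case (less y)
  consider "y = 1" | "y \<in> acm_atoms a b"
    | v w where "v \<in> acm a b - {1}" "w \<in> acm a b - {1}" "y = v * w"
    using less.prems unfolding acm_atoms_def by blast
  then show ?case
  proof cases
    case 1
    then show ?thesis by (intro exI[of _ "{#}"]) auto
  next
    case 2
    then show ?thesis by (intro exI[of _ "{#y#}"]) auto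
  next
    case (3 v w)
    then have "v > 1" "w > 1"
      using acm_ge_1[of v a b] acm_ge_1[of w a b] by auto
    then have "v < y" "w < y"
      unfolding \<open>y = v * w\<close> by simp_all
    obtain A where "set_mset A \<subseteq> acm_atoms a b" "prod_mset A = v"
      using less.IH[OF \<open>v < y\<close>] 3 by blast
    moreover obtain B where "set_mset B \<subseteq> acm_atoms a b" "prod_mset B = w"
      using less.IH[OF \<open>w < y\<close>] 3 by blast
    ultimately show ?thesis
      using 3 by (intro exI[of _ "A + B"]) auto
  qed
qed

lemma factorization_tuples_nonempty:
  assumes "y \<in> acm a b"
  shows "factorization_tuples a b y \<noteq> {}"
  using acm_eq_prod_mset_atoms[OF assms] prod_mset_in_factorization_tuples by blast

section \<open>Prime multiplicities of atoms in the case \<open>a = 1\<close>\<close>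

lemma acm_1_iff: "y \<in> acm 1 b \<longleftrightarrow> y > 0 \<and> [y = 1] (mod b)"
proof (cases "y = 1")
  case False
  then show ?thesis
    unfolding acm_def by (simp add: Suc_le_eq)
qed (simp add: acm_def)

lemma acm_1_power: "x \<in> acm 1 b \<Longrightarrow> x ^ n \<in> acm 1 b"
  unfolding acm_1_iff by (metis cong_pow power_one zero_less_power)

lemma acm_atoms_ge_2: "u \<in> acm_atoms a b \<Longrightarrow> u \<ge> 2"
  using acm_ge_1[of u a b] by (auto simp: acm_atoms_def)

text \<open>With a larger multiplicity, \<open>p ^ totient b\<close> would split off from
  \<open>u\<close>. Being congruent to 1, it leaves a cofactor congruent to 1, which contradicts
  that \<open>u\<close> is an atom.\<close>

lemma multiplicity_acm_atom_le_totient: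
  assumes "u \<in> acm_atoms 1 b" "prime p" "b \<ge> 1"
  shows "multiplicity p u \<le> totient b"
proof (rule ccontr)
  assume less: "\<not> ?thesis"
  have "u \<in> acm 1 b"
    using assms(1) unfolding acm_atoms_def by blast
  then have u: "u > 0" "[u = 1] (mod b)"
    unfolding acm_1_iff by blast+
  have t: "totient b > 0"
    using assms(3) by simp
  have "p ^ totient b dvd u"
    using less by (intro multiplicity_dvd') auto
  then obtain v where v: "u = p ^ totient b * v" ..
  have "coprime u b"
    using u(2) by (metis cong_imp_coprime cong_sym coprime_1_left)
  \<comment> \<open>Here \<open>totient b > 0\<close> matters: it makes \<open>p\<close> itself
    divide \<open>u\<close>.\<close>
  then have "coprime p b"
    using v t by auto
  then have 1: "[p ^ totient b = 1] (mod b)"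
    by (rule euler_theorem)
  then have "[p ^ totient b * v = 1 * v] (mod b)"
    by (rule cong_mult) simp
  then have "[v = 1] (mod b)"
    using u(2) v by (metis cong_sym cong_trans mult_1)
  moreover have "v > 0"
    using u(1) v by (cases v) auto
  moreover have "p ^ totient b > 1"
    using one_less_power[OF prime_gt_1_nat[OF assms(2)] t] .
  \<comment> \<open>The strictness of the negated bound enters here: the atom may well be
    \<open>p ^ totient b\<close> itself.\<close>
  moreover have "v \<noteq> 1"
  proof
    assume "v = 1"
    then have "multiplicity p u = totient b"
      using v assms(2) by (simp add: multiplicity_same_power not_prime_unit)
    then show False
      using less by simp
  qed
  ultimately have "p ^ totient b \<in> acm 1 b - {1}" "v \<in> acm 1 b - {1}"
    using 1 unfolding Diff_iff singleton_iff acm_1_iff by linarith+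
  then show False
    using assms(1) v unfolding acm_atoms_def by blast
qed

text \<open>Compare multiplicities: a prime dividing \<open>u\<close> divides \<open>x\<close>, so
  it occurs at least \<open>totient b\<close> times in \<open>x ^ totient b\<close>. The gain is
  that this exponent does not depend on \<open>n\<close>.\<close>

lemma acm_atom_dvd_power_totient:
  assumes "u \<in> acm_atoms 1 b" "b \<ge> 1" "u dvd x ^ n" "x > 0"
  shows "u dvd x ^ totient b"
proof (rule multiplicity_le_imp_dvd)
  show "u \<noteq> 0"
    using acm_atoms_ge_2[OF assms(1)] by simp
next
  fix p :: nat
  assume p: "prime p"
  show "multiplicity p u \<le> multiplicity p (x ^ totient b)"
  proof (cases "p dvd u")
    case True
    then have "p dvd x"
      using assms(3) p by (meson dvd_trans prime_dvd_power)
    then have "multiplicity p x \<ge> 1"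
      using p assms(4) by (simp add: Suc_le_eq prime_multiplicity_gt_zero_iff)
    then have "totient b \<le> multiplicity p (x ^ totient b)"
      using p assms(4) by (simp add: prime_elem_multiplicity_power_distrib)
    then show ?thesis
      using multiplicity_acm_atom_le_totient[OF assms(1) p assms(2)] by simp
  next
    case False
    then show ?thesis by (simp add: not_dvd_imp_multiplicity_0)
  qed
qed

section \<open>Bounds on the lengths of a single factorization tuple\<close>

lemma ell1_conv_sum: "ell1 z = (\<Sum>i<length z. z ! i)"
  by (simp add: ell1_def sum_list_sum_nth atLeast0LessThan)

lemma ell_inf_ge: "e \<in> set z \<Longrightarrow> e \<le> ell_inf z"
  by (simp add: ell_inf_def)

lemma ell_inf_le_ell1: "ell_inf z \<le> ell1 z"
  by (auto simp: ell_inf_def ell1_def intro: member_le_sum_list)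

lemma ell0_le_ell1: "ell0 z \<le> ell1 z"
  by (induction z) (auto simp: ell0_def ell1_def)

lemma ell1_le_ell0_mult_ell_inf: "ell1 z \<le> ell0 z * ell_inf z"
proof -
  \<comment> \<open>The bound \<open>m\<close> is arbitrary because \<open>ell_inf z\<close> would
    change along the induction over \<open>z\<close>.\<close>
  have "sum_list z \<le> length (filter (\<lambda>e. e \<noteq> 0) z) * m" if "\<And>e. e \<in> set z \<Longrightarrow> e \<le> m" for m
    using that by (induction z) (auto intro: add_mono)
  then show ?thesis
    using ell_inf_ge by (simp add: ell0_def ell1_def)
qed

lemma ell1_upper:
  assumes "z \<in> factorization_tuples a b y"
  shows "2 ^ ell1 z \<le> y"
proof -
  obtain us where us: "length us = length z" "set us \<subseteq> acm_atoms a b"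
      "y = (\<Prod>i<length z. (us ! i) ^ (z ! i))"
    using assms unfolding factorization_tuples_def by blast
  have "2 ^ ell1 z = (\<Prod>i<length z. (2::nat) ^ (z ! i))"
    by (simp add: ell1_conv_sum power_sum)
  also have "\<dots> \<le> y"
    unfolding us(3) using us(1,2)
    by (intro prod_mono) (auto intro!: power_mono acm_atoms_ge_2[of _ a b])
  finally show ?thesis .
qed

lemma ell1_upper_power:
  assumes "z \<in> factorization_tuples a b (x ^ n)"
  shows "ell1 z \<le> x * n"
proof -
  have "2 ^ ell1 z \<le> x ^ n"
    using assms by (rule ell1_upper)
  \<comment> \<open>The crude estimate \<open>x < 2 ^ x\<close> replaces the base-2 logarithm of
    \<open>x\<close> by \<open>x\<close>.\<close>
  also have "\<dots> \<le> (2 ^ x) ^ n"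
    by (intro power_mono) (auto intro: less_imp_le)
  finally show ?thesis
    by (simp flip: power_mult)
qed

context
  fixes b x n :: nat and z :: "nat list"
  assumes b: "b \<ge> 1" and x: "x > 1" and z: "z \<in> factorization_tuples 1 b (x ^ n)"
begin

text \<open>Both bounds follow from one fact: the atoms that really occur are at most
  \<open>x ^ totient b\<close>. Multiplying them gives the first bound, counting them the
  second.\<close>

lemma ell1_lower_power: "n \<le> totient b * ell1 z"
  and ell0_upper_power: "ell0 z \<le> x ^ totient b"
proof -
  obtain us where us: "length us = length z" "distinct us" "set us \<subseteq> acm_atoms 1 b"
      "x ^ n = (\<Prod>i<length z. (us ! i) ^ (z ! i))"
    using z unfolding factorization_tuples_def by blast
  have atom: "us ! i \<in> acm_atoms 1 b" if "i < length z" for i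
    using us that by auto
  \<comment> \<open>An atom listed with exponent 0 need not divide any power of \<open>x\<close>,
    hence the restriction to nonzero exponents.\<close>
  have le: "us ! i \<le> x ^ totient b" if "i < length z" "z ! i \<noteq> 0" for i
  proof (rule dvd_imp_le)
    have "us ! i dvd (us ! i) ^ (z ! i)"
      using that by (simp)
    also have "\<dots> dvd x ^ n"
      unfolding us(4) using that by (intro dvd_prodI) auto
    finally show "us ! i dvd x ^ totient b"
      using acm_atom_dvd_power_totient[OF atom b] that x by simp
  qed (use x in simp)
  have "x ^ n \<le> (\<Prod>i<length z. (x ^ totient b) ^ (z ! i))"
    unfolding us(4)
  proof (intro prod_mono conjI)
    fix i assume "i \<in> {..<length z}"
    then show "(us ! i) ^ (z ! i) \<le> (x ^ totient b) ^ (z ! i)"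
      using le[of i] by (cases "z ! i = 0") (auto intro: power_mono)
  qed simp
  also have "\<dots> = x ^ (totient b * ell1 z)"
    by (simp add: ell1_conv_sum power_sum power_mult)
  finally show "n \<le> totient b * ell1 z"
    using x by simp
  have "ell0 z = card {i. i < length z \<and> z ! i \<noteq> 0}"
    by (simp add: ell0_def length_filter_conv_card)
  also have "\<dots> \<le> card {1..x ^ totient b}"
  proof (rule card_inj_on_le)
    show "inj_on ((!) us) {i. i < length z \<and> z ! i \<noteq> 0}"
      using us(1,2) by (auto simp: inj_on_def nth_eq_iff_index_eq)
    show "(!) us ` {i. i < length z \<and> z ! i \<noteq> 0} \<subseteq> {1..x ^ totient b}"
    proof clarify
      fix i assume "i < length z" "0 < z ! i"
      then show "us ! i \<in> {1..x ^ totient b}"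
        using le[of i] acm_atoms_ge_2[OF atom[of i]] by auto
    qed
  qed simp
  finally show "ell0 z \<le> x ^ totient b"
    by simp
qed

text \<open>Pigeonhole: at least \<open>n / totient b\<close> factors are shared among at most
  \<open>x ^ totient b\<close> distinct atoms.\<close>

lemma ell_inf_lower_power: "n \<le> totient b * x ^ totient b * ell_inf z"
proof -
  have "n \<le> totient b * ell1 z"
    by (rule ell1_lower_power)
  also have "ell1 z \<le> x ^ totient b * ell_inf z"
    using ell1_le_ell0_mult_ell_inf ell0_upper_power by (meson le_trans mult_le_mono1)
  finally show ?thesis
    by (simp add: mult.assoc)
qed

lemma ell0_pos_power: "n > 0 \<Longrightarrow> ell0 z > 0"
  using ell1_lower_power ell1_le_ell0_mult_ell_inf[of z] by (cases "ell0 z") auto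

end

section \<open>Extremal values and asymptotics\<close>

text \<open>The values form a nonempty set bounded by \<open>x * n\<close>, so the extrema are
  attained and bounds for single tuples carry over to them.\<close>

lemma ell_min_max_mem:
  assumes "x \<in> acm 1 b" "\<And>z. ell z \<le> ell1 z"
  shows "ell_min ell 1 b (x ^ n) \<in> ell ` factorization_tuples 1 b (x ^ n)"
    and "ell_max ell 1 b (x ^ n) \<in> ell ` factorization_tuples 1 b (x ^ n)"
proof -
  have "ell ` factorization_tuples 1 b (x ^ n) \<subseteq> {..x * n}"
    using le_trans[OF assms(2) ell1_upper_power] by auto
  then have "finite (ell ` factorization_tuples 1 b (x ^ n))"
    by (rule finite_subset) simp
  moreover have "ell ` factorization_tuples 1 b (x ^ n) \<noteq> {}"
    using factorization_tuples_nonempty[OF acm_1_power[OF assms(1)]] by simp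
  ultimately show "ell_min ell 1 b (x ^ n) \<in> ell ` factorization_tuples 1 b (x ^ n)"
    and "ell_max ell 1 b (x ^ n) \<in> ell ` factorization_tuples 1 b (x ^ n)"
    unfolding ell_min_def ell_max_def by (rule Min_in Max_in; assumption)+
qed

text \<open>The restriction to \<open>n > 0\<close> is essential for \<open>ell0\<close>:
  \<open>x ^ 0 = 1\<close> has only tuples with \<open>ell0\<close> equal to 0, which no constant
  multiple lifts to 1.\<close>

lemma bigtheta_natI:
  fixes f g :: "nat \<Rightarrow> nat"
  assumes "\<And>n. n > 0 \<Longrightarrow> f n \<le> C * g n" "\<And>n. n > 0 \<Longrightarrow> g n \<le> D * f n"
  shows "(\<lambda>n. real (f n)) \<in> \<Theta>(\<lambda>n. real (g n))"
proof -
  have *: "(\<lambda>n. real (f n)) \<in> O(\<lambda>n. real (g n))"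
    if "\<And>n. n > 0 \<Longrightarrow> f n \<le> C * g n" for f g :: "nat \<Rightarrow> nat" and C
  proof (rule bigoI[of _ "real C"])
    show "\<forall>\<^sub>F n in sequentially. norm (real (f n)) \<le> real C * norm (real (g n))"
      using eventually_gt_at_top[of 0]
      by eventually_elim (use that in \<open>simp flip: of_nat_mult\<close>)
  qed
  show ?thesis
    using *[of f C g] *[of g D f] assms by (simp add: bigtheta_def bigomega_iff_bigo)
qed

theorem theorem3p2:
  fixes a b x :: nat
  assumes "acm_params a b"
    and "a = 1"
    and "x \<in> acm a b"
    and "x > 1"
  shows "(\<lambda>n::nat. real (ell_min ell1 a b (x ^ n))) \<in> \<Theta>(\<lambda>n. real n)
    \<and> (\<lambda>n::nat. real (ell_min ell_inf a b (x ^ n))) \<in> \<Theta>(\<lambda>n. real n)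
    \<and> (\<lambda>n::nat. real (ell_max ell0 a b (x ^ n))) \<in> \<Theta>(\<lambda>n. 1)"
proof (intro conjI)
  have b: "b \<ge> 1" and x: "x \<in> acm 1 b"
    using assms by (auto simp: acm_params_def)
  show "(\<lambda>n. real (ell_min ell1 a b (x ^ n))) \<in> \<Theta>(\<lambda>n. real n)"
  proof (rule bigtheta_natI)
    fix n
    obtain z where "z \<in> factorization_tuples 1 b (x ^ n)" "ell_min ell1 a b (x ^ n) = ell1 z"
      using ell_min_max_mem(1)[OF x, of ell1 n] assms(2) by auto
    then show "ell_min ell1 a b (x ^ n) \<le> x * n" "n \<le> totient b * ell_min ell1 a b (x ^ n)"
      using ell1_upper_power ell1_lower_power[OF b assms(4)] by auto
  qed
  show "(\<lambda>n. real (ell_min ell_inf a b (x ^ n))) \<in> \<Theta>(\<lambda>n. real n)"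
  proof (rule bigtheta_natI)
    fix n
    obtain z where "z \<in> factorization_tuples 1 b (x ^ n)" "ell_min ell_inf a b (x ^ n) = ell_inf z"
      using ell_min_max_mem(1)[OF x, of ell_inf n, OF ell_inf_le_ell1] assms(2) by auto
    then show "ell_min ell_inf a b (x ^ n) \<le> x * n"
        "n \<le> totient b * x ^ totient b * ell_min ell_inf a b (x ^ n)"
      using le_trans[OF ell_inf_le_ell1 ell1_upper_power] ell_inf_lower_power[OF b assms(4)]
      by auto
  qed
  \<comment> \<open>The constant is written as \<open>real 1\<close> so that
    \<open>bigtheta_natI\<close> applies with a natural-valued \<open>g\<close>.\<close>
  have "(\<lambda>n. real (ell_max ell0 a b (x ^ n))) \<in> \<Theta>(\<lambda>n. real 1)"
  proof (rule bigtheta_natI)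
    fix n :: nat
    assume "n > 0"
    obtain z where "z \<in> factorization_tuples 1 b (x ^ n)" "ell_max ell0 a b (x ^ n) = ell0 z"
      using ell_min_max_mem(2)[OF x, of ell0 n, OF ell0_le_ell1] assms(2) by auto
    then show "ell_max ell0 a b (x ^ n) \<le> x ^ totient b * 1" "1 \<le> 1 * ell_max ell0 a b (x ^ n)"
      using ell0_upper_power[OF b assms(4)] ell0_pos_power[OF b assms(4) _ \<open>n > 0\<close>]
      by (auto simp: Suc_le_eq)
  qed
  then show "(\<lambda>n. real (ell_max ell0 a b (x ^ n))) \<in> \<Theta>(\<lambda>n. 1)"
    by simp
qed

end
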